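(* Let $\gamma\in\mathbb{R}$, $\gamma\ge0$. The dimer system $$\begin{cases} i \dot{q}_0 = q_1 - i\gamma q_0 + \frac12\left(|q_0|^2 + |q_1|^2\right) q_0, \\ i \dot{q}_1 = q_0 + i \gamma q_1 + \frac12\left(|q_0|^2 + |q_1|^2\right) q_1 \end{cases}$$ admits two integrals of motion: the quantities $$S_1=q_0\bar q_1+\bar q_0 q_1\qquad\text{and}\qquad Q=S_0-\gamma S_2,$$ where $S_0=|q_0|^2+|q_1|^2$ and $S_2=i(q_0\bar q_1-\bar q_0q_1)$, are constant in time along every solution.
   Context: $q_0,q_1$ are complex-valued functions of the real variable $t$; the overdot denotes $d/dt$ and the overbar complex conjugation. *)

theory Defs
  imports "HOL-Analysis.Analysis"
begin

text \<open>The derivatives are taken within \<open>I\<close>, so they are one-sided at an endpoint belonging to \<open>I\<close>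
  and two-sided in its interior.\<close>

definition dimer_solution ::
    "real \<Rightarrow> real set \<Rightarrow> (real \<Rightarrow> complex) \<Rightarrow> (real \<Rightarrow> complex) \<Rightarrow> bool" where
  "dimer_solution \<gamma> I q0 q1 \<longleftrightarrow>
     (\<forall>t\<in>I. \<exists>dq0 dq1.
        (q0 has_vector_derivative dq0) (at t within I) \<and>
        (q1 has_vector_derivative dq1) (at t within I) \<and>
        \<i> * dq0 = q1 t - \<i> * complex_of_real \<gamma> * q0 t
          + (1/2) * complex_of_real ((cmod (q0 t))\<^sup>2 + (cmod (q1 t))\<^sup>2) * q0 t \<and>
        \<i> * dq1 = q0 t + \<i> * complex_of_real \<gamma> * q1 t
          + (1/2) * complex_of_real ((cmod (q0 t))\<^sup>2 + (cmod (q1 t))\<^sup>2) * q1 t)"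

text \<open>The interval of existence is arbitrary: solutions need not be defined for all real times.\<close>

definition dimer_integral_of_motion :: "real \<Rightarrow> (complex \<Rightarrow> complex \<Rightarrow> complex) \<Rightarrow> bool" where
  "dimer_integral_of_motion \<gamma> F \<longleftrightarrow>
     (\<forall>I q0 q1. is_interval I \<longrightarrow> dimer_solution \<gamma> I q0 q1 \<longrightarrow>
        (\<lambda>t. F (q0 t) (q1 t)) constant_on I)"

definition S0 :: "complex \<Rightarrow> complex \<Rightarrow> complex" where
  "S0 a b = complex_of_real ((cmod a)\<^sup>2 + (cmod b)\<^sup>2)"

definition S1 :: "complex \<Rightarrow> complex \<Rightarrow> complex" where
  "S1 a b = a * cnj b + cnj a * b"

definition S2 :: "complex \<Rightarrow> complex \<Rightarrow> complex" where
  "S2 a b = \<i> * (a * cnj b - cnj a * b)"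

definition Q :: "real \<Rightarrow> complex \<Rightarrow> complex \<Rightarrow> complex" where
  "Q \<gamma> a b = S0 a b - complex_of_real \<gamma> * S2 a b"

end

theory Submission
  imports Defs
begin

text \<open>With \<open>S3 = |q0|\<^sup>2 - |q1|\<^sup>2\<close>, the equations of motion give \<open>(q0 cnj q1)' = \<i> S3\<close>, which is purely
  imaginary, so that \<open>S1' = 0\<close> and \<open>S2' = - 2 S3\<close>; the Hermitian coupling and the nonlinearity
  conserve \<open>S0\<close>, so that gain and loss alone give \<open>S0' = - 2 \<gamma> S3\<close>.\<close>

text \<open>Turns the squared moduli into products of the amplitudes with their conjugates, to which
  the product rule applies.\<close>

lemma S0_eq_mult_cnj: "S0 a b = a * cnj a + b * cnj b"
  by (simp add: S0_def flip: complex_norm_square)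

text \<open>Solves the system for the derivatives and folds the nonlinear factor into
  \<open>S0\<close>, of which only the reality matters for the cancellations below.\<close>

lemma dimer_solutionE:
  assumes "dimer_solution \<gamma> I q0 q1" "t \<in> I"
  obtains dq0 dq1 where
    "(q0 has_vector_derivative dq0) (at t within I)"
    "(q1 has_vector_derivative dq1) (at t within I)"
    "dq0 = - \<i> * q1 t - of_real \<gamma> * q0 t - \<i> / 2 * S0 (q0 t) (q1 t) * q0 t"
    "dq1 = - \<i> * q0 t + of_real \<gamma> * q1 t - \<i> / 2 * S0 (q0 t) (q1 t) * q1 t"
proof -
  obtain dq0 dq1 where
    der: "(q0 has_vector_derivative dq0) (at t within I)"
      "(q1 has_vector_derivative dq1) (at t within I)" and
    eq0: "\<i> * dq0 = q1 t - \<i> * of_real \<gamma> * q0 t + (1/2) * S0 (q0 t) (q1 t) * q0 t" and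
    eq1: "\<i> * dq1 = q0 t + \<i> * of_real \<gamma> * q1 t + (1/2) * S0 (q0 t) (q1 t) * q1 t"
    using assms unfolding dimer_solution_def S0_def by blast
  \<comment> \<open>Rewriting \<open>dq0\<close> in this way exposes \<open>\<i> * dq0\<close>, the
    left-hand side of the equation of motion.\<close>
  have cancel: "z = - \<i> * (\<i> * z)" for z :: complex
    by (simp flip: mult.assoc)
  have "dq0 = - \<i> * q1 t - of_real \<gamma> * q0 t - \<i> / 2 * S0 (q0 t) (q1 t) * q0 t"
    by (subst cancel, subst eq0) (simp add: algebra_simps)
  moreover have "dq1 = - \<i> * q0 t + of_real \<gamma> * q1 t - \<i> / 2 * S0 (q0 t) (q1 t) * q1 t"
    by (subst cancel, subst eq1) (simp add: algebra_simps)
  ultimately show thesis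
    using der that by blast
qed

lemma dimer_has_vector_derivative:
  assumes "dimer_solution \<gamma> I q0 q1" "t \<in> I"
  defines "S3 \<equiv> q0 t * cnj (q0 t) - q1 t * cnj (q1 t)"
  shows has_vector_derivative_S0:
      "((\<lambda>t. S0 (q0 t) (q1 t)) has_vector_derivative - 2 * of_real \<gamma> * S3) (at t within I)"
    and has_vector_derivative_S1:
      "((\<lambda>t. S1 (q0 t) (q1 t)) has_vector_derivative 0) (at t within I)"
    and has_vector_derivative_S2:
      "((\<lambda>t. S2 (q0 t) (q1 t)) has_vector_derivative - 2 * S3) (at t within I)"
proof -
  obtain dq0 dq1 where der [derivative_intros]:
      "(q0 has_vector_derivative dq0) (at t within I)"
      "(q1 has_vector_derivative dq1) (at t within I)"
    and eqs: "dq0 = - \<i> * q1 t - of_real \<gamma> * q0 t - \<i> / 2 * S0 (q0 t) (q1 t) * q0 t"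
      "dq1 = - \<i> * q0 t + of_real \<gamma> * q1 t - \<i> / 2 * S0 (q0 t) (q1 t) * q1 t"
    by (rule dimer_solutionE[OF assms(1,2)])
  \<comment> \<open>As \<open>S0\<close> is real, the nonlinearity is a common phase rotation of
    both amplitudes; it drops out of every product of one amplitude with a conjugate one.\<close>
  have cnj_S0: "cnj (S0 (q0 t) (q1 t)) = S0 (q0 t) (q1 t)"
    by (simp add: S0_def)
  show "((\<lambda>t. S0 (q0 t) (q1 t)) has_vector_derivative - 2 * of_real \<gamma> * S3) (at t within I)"
    unfolding S0_eq_mult_cnj
    by (rule derivative_eq_intros refl | simp)+
      (simp add: eqs cnj_S0 S3_def algebra_simps)
  \<comment> \<open>\<open>S1\<close> and \<open>S2\<close> are built from this product and its
    conjugate. In its derivative the gain \<open>\<gamma>\<close> and the loss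
    \<open>- \<gamma>\<close> cancel, so only the coupling contributes.\<close>
  have "((\<lambda>t. q0 t * cnj (q1 t)) has_vector_derivative q0 t * cnj dq1 + dq0 * cnj (q1 t))
      (at t within I)"
    by (intro derivative_intros)
  moreover have "q0 t * cnj dq1 + dq0 * cnj (q1 t) = \<i> * S3"
    by (simp add: eqs cnj_S0 S3_def algebra_simps)
  ultimately have [derivative_intros]:
    "((\<lambda>t. q0 t * cnj (q1 t)) has_vector_derivative \<i> * S3) (at t within I)"
    by simp
  \<comment> \<open>Conjugation spares a second product rule; as \<open>S3\<close> is real, it just
    flips the sign of \<open>\<i> * S3\<close>.\<close>
  have "((\<lambda>t. cnj (q0 t * cnj (q1 t))) has_vector_derivative cnj (\<i> * S3)) (at t within I)"
    by (intro derivative_intros)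
  moreover have "cnj (\<i> * S3) = - \<i> * S3"
    by (simp add: S3_def algebra_simps)
  ultimately have [derivative_intros]:
    "((\<lambda>t. cnj (q0 t) * q1 t) has_vector_derivative - \<i> * S3) (at t within I)"
    by simp
  have "((\<lambda>t. q0 t * cnj (q1 t) + cnj (q0 t) * q1 t) has_vector_derivative
      \<i> * S3 + - \<i> * S3) (at t within I)"
    by (intro has_vector_derivative_add derivative_intros)
  then show "((\<lambda>t. S1 (q0 t) (q1 t)) has_vector_derivative 0) (at t within I)"
    by (simp add: S1_def)
  have "((\<lambda>t. \<i> * (q0 t * cnj (q1 t) - cnj (q0 t) * q1 t)) has_vector_derivative
      \<i> * (\<i> * S3 - - \<i> * S3)) (at t within I)"
    by (intro has_vector_derivative_mult_right has_vector_derivative_diff derivative_intros)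
  then show "((\<lambda>t. S2 (q0 t) (q1 t)) has_vector_derivative - 2 * S3) (at t within I)"
    by (simp add: S2_def algebra_simps)
qed

text \<open>Intervals are convex, and a function whose derivative within a convex set vanishes is
  constant there.\<close>

lemma dimer_integral_of_motionI:
  assumes "\<And>I q0 q1 t. dimer_solution \<gamma> I q0 q1 \<Longrightarrow> t \<in> I \<Longrightarrow>
    ((\<lambda>t. F (q0 t) (q1 t)) has_vector_derivative 0) (at t within I)"
  shows "dimer_integral_of_motion \<gamma> F"
  unfolding dimer_integral_of_motion_def constant_on_def
  by (metis assms has_vector_derivative_zero_constant is_interval_convex)

theorem mainTheorem9:
  fixes \<gamma> :: real
  assumes "\<gamma> \<ge> 0"
  shows "dimer_integral_of_motion \<gamma> S1 \<and> dimer_integral_of_motion \<gamma> (Q \<gamma>)"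
proof
  show "dimer_integral_of_motion \<gamma> S1"
    by (intro dimer_integral_of_motionI has_vector_derivative_S1)
  show "dimer_integral_of_motion \<gamma> (Q \<gamma>)"
  proof (rule dimer_integral_of_motionI)
    fix I q0 q1 t
    assume sol: "dimer_solution \<gamma> I q0 q1" "t \<in> I"
    show "((\<lambda>t. Q \<gamma> (q0 t) (q1 t)) has_vector_derivative 0) (at t within I)"
      \<comment> \<open>The weight \<open>\<gamma>\<close> in \<open>Q\<close> is the ratio of the
        two derivatives: \<open>- 2 * \<gamma> * S3 - \<gamma> * (- 2 * S3) = 0\<close>.\<close>
      using has_vector_derivative_diff[OF has_vector_derivative_S0[OF sol]
          has_vector_derivative_mult_right[OF has_vector_derivative_S2[OF sol], of "of_real \<gamma>"]]
      by (simp add: Q_def algebra_simps)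
  qed
qed

end
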